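(* Fix a generalized ring structure on $\Gamma$. (1) For every centrally $\Gamma$-graded group $G$ there is a centrally $\Gamma$-graded group $G^\vee$ (the braided dual group), given by the same set $G^\vee=G$, with the same grading $d$ and central map $Z$ as $G$, and product $x\bullet y=Z^{d(y)d(x)}\,xy$. (2) For two centrally $\Gamma$-graded groups $G_1,G_2$, there is a group structure, denoted $G_1\widehat\times_Z G_2$, on the product $G_1\times_z G_2$, given by the group law $$[g_1,g_2]\cdot[h_1,h_2]=Z^{d(h_1)d(g_2)}[g_1h_1,g_2h_2].$$ (3) Iteration of the preceding construction is associative: the natural map $(G_1\widehat\times_Z G_2)\widehat\times_Z G_3\to G_1\widehat\times_Z(G_2\widehat\times_Z G_3)$, $[[g_1,g_2],g_3]\mapsto[g_1,[g_2,g_3]]$, is a group isomorphism. (4) When $\Gamma$ is skew (i.e. $ab+ba=0$ for all $a,b\in\Gamma$), the braiding map $\beta_{G_1,G_2}:[g_1,g_2]\mapsto Z^{d(g_2)d(g_1)}[g_2,g_1]$ is an isomorphism of groups from $G_1\widehat\times_Z G_2$ onto $G_2\widehat\times_Z G_1$.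
   Context: A generalized ring is an abelian group $(\Gamma,+)$ with a bi-additive map $\Gamma^2\to\Gamma$, $(a,b)\mapsto ab$ (no associativity, commutativity or unit required). A centrally $\Gamma$-graded group is a group $G$ with a group morphism $d:G\to(\Gamma,+)$ (grading) and a group morphism $Z:(\Gamma,+)\to G$, $x\mapsto Z^x$, with values in the center of $G$ and such that $d(Z^x)=0$ for all $x$. The underlying set of $G_1\times_z G_2$ is the quotient of $G_1\times G_2$ by the relation $(Z_1^xg_1,g_2)\sim(g_1,Z_2^xg_2)$ for all $x\in\Gamma$ (where $Z_i$ is the central map of $G_i$); $[g_1,g_2]$ denotes the class of $(g_1,g_2)$. It carries the grading $d([g_1,g_2])=d(g_1)+d(g_2)$, and the notation $Z^x[g_1,g_2]$ means $[Z_1^xg_1,g_2]=[g_1,Z_2^xg_2]$; the central map of $G_1\widehat\times_Z G_2$ is $x\mapsto Z^x=[Z_1^x,1]=[1,Z_2^x]$. *)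

theory Defs
  imports "HOL-Algebra.Ring"
begin

text \<open>
  A generalized ring: an abelian group with a bi-additive product. The ring record supplies the
  operations; its unit field is not used, and the product need be neither associative,
  commutative nor unital.
\<close>

locale generalized_ring = abelian_group R for R (structure) +
  assumes prod_closed: "\<lbrakk> a \<in> carrier R; b \<in> carrier R \<rbrakk> \<Longrightarrow> a \<otimes> b \<in> carrier R"
    and prod_add_left: "\<lbrakk> a \<in> carrier R; b \<in> carrier R; c \<in> carrier R \<rbrakk>
        \<Longrightarrow> (a \<oplus> b) \<otimes> c = a \<otimes> c \<oplus> b \<otimes> c"
    and prod_add_right: "\<lbrakk> a \<in> carrier R; b \<in> carrier R; c \<in> carrier R \<rbrakk>
        \<Longrightarrow> c \<otimes> (a \<oplus> b) = c \<otimes> a \<oplus> c \<otimes> b"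

definition skew :: "('g, 'm) ring_scheme \<Rightarrow> bool" where
  "skew R \<longleftrightarrow> (\<forall>a\<in>carrier R. \<forall>b\<in>carrier R. a \<otimes>\<^bsub>R\<^esub> b \<oplus>\<^bsub>R\<^esub> b \<otimes>\<^bsub>R\<^esub> a = \<zero>\<^bsub>R\<^esub>)"

record ('a, 'g) graded_group = "'a monoid" +
  grading :: "'a \<Rightarrow> 'g"
  central :: "'g \<Rightarrow> 'a"

locale centrally_graded_group = abelian_group R + group G
  for R :: "('g, 'm) ring_scheme" and G :: "('a, 'g) graded_group" +
  assumes grading_hom: "grading G \<in> hom G (add_monoid R)"
    and central_hom: "central G \<in> hom (add_monoid R) G"
    and central_commutes: "\<lbrakk> x \<in> carrier R; g \<in> carrier G \<rbrakk>
        \<Longrightarrow> central G x \<otimes>\<^bsub>G\<^esub> g = g \<otimes>\<^bsub>G\<^esub> central G x"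
    and grading_central: "x \<in> carrier R \<Longrightarrow> grading G (central G x) = \<zero>\<^bsub>R\<^esub>"

definition braided_dual ::
  "('g, 'm) ring_scheme \<Rightarrow> ('a, 'g) graded_group \<Rightarrow> ('a, 'g) graded_group" where
  "braided_dual R G = G \<lparr> mult :=
     (\<lambda>x y. central G (grading G y \<otimes>\<^bsub>R\<^esub> grading G x) \<otimes>\<^bsub>G\<^esub> (x \<otimes>\<^bsub>G\<^esub> y)) \<rparr>"

definition zrel :: "('g, 'm) ring_scheme \<Rightarrow> ('a, 'g) graded_group \<Rightarrow> ('b, 'g) graded_group
    \<Rightarrow> (('a \<times> 'b) \<times> ('a \<times> 'b)) set" where
  "zrel R G1 G2 =
     {((central G1 x \<otimes>\<^bsub>G1\<^esub> g1, g2), (g1, central G2 x \<otimes>\<^bsub>G2\<^esub> g2)) | x g1 g2.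
        x \<in> carrier R \<and> g1 \<in> carrier G1 \<and> g2 \<in> carrier G2}"

definition zclass :: "('g, 'm) ring_scheme \<Rightarrow> ('a, 'g) graded_group \<Rightarrow> ('b, 'g) graded_group
    \<Rightarrow> 'a \<Rightarrow> 'b \<Rightarrow> ('a \<times> 'b) set" where
  "zclass R G1 G2 g1 g2 = zrel R G1 G2 `` {(g1, g2)}"

text \<open>The notation $Z^x [g_1, g_2]$.\<close>

definition zshift :: "('g, 'm) ring_scheme \<Rightarrow> ('a, 'g) graded_group \<Rightarrow> ('b, 'g) graded_group
    \<Rightarrow> 'g \<Rightarrow> 'a \<Rightarrow> 'b \<Rightarrow> ('a \<times> 'b) set" where
  "zshift R G1 G2 x g1 g2 = zclass R G1 G2 (central G1 x \<otimes>\<^bsub>G1\<^esub> g1) g2"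

text \<open>
  Functions out of the quotient are written by applying a formula to all representatives and
  extracting the common value with \<open>the_elem\<close>, which is unspecified unless the formula takes
  the same value on all of them.
\<close>

definition braided_prod :: "('g, 'm) ring_scheme \<Rightarrow> ('a, 'g) graded_group
    \<Rightarrow> ('b, 'g) graded_group \<Rightarrow> (('a \<times> 'b) set, 'g) graded_group" where
  "braided_prod R G1 G2 =
     \<lparr> carrier = (carrier G1 \<times> carrier G2) // zrel R G1 G2,
       mult = (\<lambda>X Y. the_elem
         ((\<lambda>((g1, g2), (h1, h2)).
             zshift R G1 G2 (grading G1 h1 \<otimes>\<^bsub>R\<^esub> grading G2 g2)
               (g1 \<otimes>\<^bsub>G1\<^esub> h1) (g2 \<otimes>\<^bsub>G2\<^esub> h2)) ` (X \<times> Y))),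
       one = zclass R G1 G2 \<one>\<^bsub>G1\<^esub> \<one>\<^bsub>G2\<^esub>,
       grading = (\<lambda>X. the_elem ((\<lambda>(g1, g2). grading G1 g1 \<oplus>\<^bsub>R\<^esub> grading G2 g2) ` X)),
       central = (\<lambda>x. zclass R G1 G2 (central G1 x) \<one>\<^bsub>G2\<^esub>) \<rparr>"

definition braided_assoc :: "('g, 'm) ring_scheme \<Rightarrow> ('a, 'g) graded_group
    \<Rightarrow> ('b, 'g) graded_group \<Rightarrow> ('c, 'g) graded_group
    \<Rightarrow> (('a \<times> 'b) set \<times> 'c) set \<Rightarrow> ('a \<times> ('b \<times> 'c) set) set" where
  "braided_assoc R G1 G2 G3 X = the_elem
     ((\<lambda>(Y, g3). the_elem
        ((\<lambda>(g1, g2). zclass R G1 (braided_prod R G2 G3) g1 (zclass R G2 G3 g2 g3)) ` Y)) ` X)"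

definition braiding :: "('g, 'm) ring_scheme \<Rightarrow> ('a, 'g) graded_group
    \<Rightarrow> ('b, 'g) graded_group \<Rightarrow> ('a \<times> 'b) set \<Rightarrow> ('b \<times> 'a) set" where
  "braiding R G1 G2 X = the_elem
     ((\<lambda>(g1, g2). zshift R G2 G1 (grading G2 g2 \<otimes>\<^bsub>R\<^esub> grading G1 g1) g2 g1) ` X)"

end

theory Submission
  imports Defs
begin

text \<open>
  Write \<open>Z\<^sup>x g\<close> for the action of \<open>\<Gamma>\<close> on a centrally graded group by multiplication with central
  elements. It commutes with products on either side and does not change degrees, so in every
  identity below the powers of \<open>Z\<close> can be collected in front and the identity reduces to an
  equation between their exponents, which follows from biadditivity (and from skewness for the
  braiding). A class \<open>[g\<^sub>1, g\<^sub>2]\<close> is an orbit under moving \<open>Z\<^sup>x\<close> from one factor to the other; in the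
  braided product \<open>Z\<^sup>x [g\<^sub>1, g\<^sub>2] = [Z\<^sup>x g\<^sub>1, g\<^sub>2] = [g\<^sub>1, Z\<^sup>x g\<^sub>2]\<close>, so the product is again centrally
  graded and the construction can be iterated.
\<close>

section \<open>Functions on quotients, evaluated at a representative\<close>

lemma the_elem_image_class:
  assumes "equiv A r" "a \<in> A" "\<And>x y. (x, y) \<in> r \<Longrightarrow> f x = f y"
  shows "the_elem (f ` (r `` {a})) = f a"
proof -
  have "a \<in> r `` {a}"
    using assms(1,2) by (rule equiv_class_self)
  moreover have "f x = f a" if "x \<in> r `` {a}" for x
    using that assms(3)[of a x] by simp
  ultimately have "f ` (r `` {a}) = {f a}"
    by blast
  then show ?thesis
    by simp
qed

text \<open>Invariance is only required in one argument at a time, with the other fixed in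
  \<open>A\<close>: the values at \<open>(a, b)\<close> and \<open>(x, y)\<close> are compared
  through \<open>(a, y)\<close>.\<close>

lemma the_elem_image_class2:
  assumes "equiv A r" "a \<in> A" "b \<in> A"
    and "\<And>x y z. (x, y) \<in> r \<Longrightarrow> z \<in> A \<Longrightarrow> f (x, z) = f (y, z)"
    and "\<And>x y z. (x, y) \<in> r \<Longrightarrow> z \<in> A \<Longrightarrow> f (z, x) = f (z, y)"
  shows "the_elem (f ` (r `` {a} \<times> r `` {b})) = f (a, b)"
proof -
  have *: "f (x, y) = f (a, b)" if "(a, x) \<in> r" "(b, y) \<in> r" for x y
  proof -
    have "y \<in> A"
      using equiv_type[OF assms(1)] that(2) by blast
    then show ?thesis
      using assms(2) assms(4)[OF that(1)] assms(5)[OF that(2)] by simp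
  qed
  have "(a, b) \<in> r `` {a} \<times> r `` {b}"
    using equiv_class_self[OF assms(1)] assms(2,3) by blast
  moreover have "f p = f (a, b)" if "p \<in> r `` {a} \<times> r `` {b}" for p
    using that * by blast
  ultimately have "f ` (r `` {a} \<times> r `` {b}) = {f (a, b)}"
    by blast
  then show ?thesis
    by simp
qed

section \<open>Consequences of biadditivity\<close>

context generalized_ring
begin

lemma prod_zero_left [simp]:
  assumes "a \<in> carrier R" shows "\<zero> \<otimes> a = \<zero>"
proof -
  have "\<zero> \<otimes> a \<oplus> \<zero> \<otimes> a = \<zero> \<otimes> a"
    using prod_add_left[of \<zero> \<zero> a] assms by simp
  then show ?thesis
    using add.l_cancel_one[of "\<zero> \<otimes> a" "\<zero> \<otimes> a"] assms by (simp add: prod_closed)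
qed

lemma prod_zero_right [simp]:
  assumes "a \<in> carrier R" shows "a \<otimes> \<zero> = \<zero>"
proof -
  have "a \<otimes> \<zero> \<oplus> a \<otimes> \<zero> = a \<otimes> \<zero>"
    using prod_add_right[of \<zero> \<zero> a] assms by simp
  then show ?thesis
    using add.l_cancel_one[of "a \<otimes> \<zero>" "a \<otimes> \<zero>"] assms by (simp add: prod_closed)
qed

lemma prod_minus_right:
  assumes "a \<in> carrier R" "b \<in> carrier R" shows "a \<otimes> (\<ominus> b) = \<ominus> (a \<otimes> b)"
proof -
  have "a \<otimes> (\<ominus> b) \<oplus> a \<otimes> b = \<zero>"
    using assms prod_add_right[of "\<ominus> b" b a] by (simp add: l_neg)
  then show ?thesis
    using assms minus_equality[of "a \<otimes> (\<ominus> b)" "a \<otimes> b"] by (simp add: prod_closed)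
qed

end

section \<open>The action of \<Gamma> on a centrally graded group\<close>

definition zact :: "('a, 'g) graded_group \<Rightarrow> 'g \<Rightarrow> 'a \<Rightarrow> 'a" where
  "zact G x g = central G x \<otimes>\<^bsub>G\<^esub> g"

context centrally_graded_group
begin

lemma grading_closed [simp]: "g \<in> carrier G \<Longrightarrow> grading G g \<in> carrier R"
  using grading_hom by (auto simp: hom_def)

lemma grading_mult [simp]:
  "\<lbrakk> g \<in> carrier G; h \<in> carrier G \<rbrakk>
    \<Longrightarrow> grading G (g \<otimes>\<^bsub>G\<^esub> h) = grading G g \<oplus>\<^bsub>R\<^esub> grading G h"
  using grading_hom by (auto simp: hom_def)

lemma grading_one [simp]: "grading G \<one>\<^bsub>G\<^esub> = \<zero>\<^bsub>R\<^esub>"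
  using hom_one[OF grading_hom is_group add.is_group] by simp

lemma grading_inv [simp]:
  assumes "g \<in> carrier G" shows "grading G (inv\<^bsub>G\<^esub> g) = \<ominus>\<^bsub>R\<^esub> grading G g"
proof -
  have "grading G (inv\<^bsub>G\<^esub> g) \<oplus>\<^bsub>R\<^esub> grading G g = \<zero>\<^bsub>R\<^esub>"
    using assms by (simp flip: grading_mult)
  then show ?thesis
    using assms minus_equality[of "grading G (inv\<^bsub>G\<^esub> g)" "grading G g"] by simp
qed

lemma central_closed [simp]: "x \<in> carrier R \<Longrightarrow> central G x \<in> carrier G"
  using central_hom by (auto simp: hom_def)

lemma central_add:
  "\<lbrakk> x \<in> carrier R; y \<in> carrier R \<rbrakk>
    \<Longrightarrow> central G (x \<oplus>\<^bsub>R\<^esub> y) = central G x \<otimes>\<^bsub>G\<^esub> central G y"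
  using central_hom by (auto simp: hom_def)

lemma central_zero [simp]: "central G \<zero>\<^bsub>R\<^esub> = \<one>\<^bsub>G\<^esub>"
  using hom_one[OF central_hom add.is_group is_group] by simp

lemma zact_closed [simp]: "\<lbrakk> x \<in> carrier R; g \<in> carrier G \<rbrakk> \<Longrightarrow> zact G x g \<in> carrier G"
  by (simp add: zact_def)

lemma zact_zero [simp]: "g \<in> carrier G \<Longrightarrow> zact G \<zero>\<^bsub>R\<^esub> g = g"
  by (simp add: zact_def)

lemma zact_zact [simp]:
  "\<lbrakk> x \<in> carrier R; y \<in> carrier R; g \<in> carrier G \<rbrakk>
    \<Longrightarrow> zact G x (zact G y g) = zact G (x \<oplus>\<^bsub>R\<^esub> y) g"
  by (simp add: zact_def central_add m_assoc)

lemma zact_mult_left [simp]: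
  "\<lbrakk> x \<in> carrier R; g \<in> carrier G; h \<in> carrier G \<rbrakk>
    \<Longrightarrow> zact G x g \<otimes>\<^bsub>G\<^esub> h = zact G x (g \<otimes>\<^bsub>G\<^esub> h)"
  by (simp add: zact_def m_assoc)

text \<open>The only direct appeal to \<open>central_commutes\<close>; later arguments use
  centrality through this rule.\<close>

lemma zact_mult_right [simp]:
  assumes "x \<in> carrier R" "g \<in> carrier G" "h \<in> carrier G"
  shows "g \<otimes>\<^bsub>G\<^esub> zact G x h = zact G x (g \<otimes>\<^bsub>G\<^esub> h)"
proof -
  have "g \<otimes>\<^bsub>G\<^esub> (central G x \<otimes>\<^bsub>G\<^esub> h) = (central G x \<otimes>\<^bsub>G\<^esub> g) \<otimes>\<^bsub>G\<^esub> h"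
    using assms by (simp add: central_commutes m_assoc)
  then show ?thesis
    using assms by (simp add: zact_def m_assoc)
qed

lemma grading_zact [simp]:
  "\<lbrakk> x \<in> carrier R; g \<in> carrier G \<rbrakk> \<Longrightarrow> grading G (zact G x g) = grading G g"
  by (simp add: zact_def grading_central)

text \<open>Brings central elements under the rewrite rules for the action.\<close>

lemma central_eq_zact: "x \<in> carrier R \<Longrightarrow> central G x = zact G x \<one>\<^bsub>G\<^esub>"
  by (simp add: zact_def)

end

section \<open>The braided dual group\<close>

text \<open>The twist is biadditive in the degrees, hence a 2-cocycle: both bracketings of a triple
  product of x, y, z carry the exponent d(y)d(x) + d(z)d(x) + d(z)d(y).\<close>

lemma centrally_graded_group_braided_dual:
  assumes "generalized_ring R" "centrally_graded_group R G"
  shows "centrally_graded_group R (braided_dual R G)"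
proof -
  interpret generalized_ring R by fact
  interpret G: centrally_graded_group R G by fact
  let ?D = "braided_dual R G"
  have D: "carrier ?D = carrier G" "\<one>\<^bsub>?D\<^esub> = \<one>\<^bsub>G\<^esub>" "grading ?D = grading G"
    "central ?D = central G"
    "x \<otimes>\<^bsub>?D\<^esub> y = zact G (grading G y \<otimes>\<^bsub>R\<^esub> grading G x) (x \<otimes>\<^bsub>G\<^esub> y)" for x y
    by (simp_all add: braided_dual_def zact_def)
  have grp: "group ?D"
  proof (rule groupI)
    \<comment> \<open>The inverse of x in \<open>G\<close> has degree -d(x), so multiplying it by x
      twists by -d(x)d(x); the factor in the witness cancels this.\<close>
    show "\<exists>y\<in>carrier ?D. y \<otimes>\<^bsub>?D\<^esub> x = \<one>\<^bsub>?D\<^esub>" if "x \<in> carrier ?D" for x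
      using that
      by (intro bexI[of _ "zact G (grading G x \<otimes>\<^bsub>R\<^esub> grading G x) (inv\<^bsub>G\<^esub> x)"])
        (simp_all add: D prod_closed prod_minus_right l_neg)
  qed (simp_all add: D prod_closed prod_add_left prod_add_right G.m_assoc add.m_ac)
  show ?thesis
  proof (intro centrally_graded_group.intro centrally_graded_group_axioms.intro grp)
    show "grading ?D \<in> hom ?D (add_monoid R)"
      by (rule homI) (simp_all add: D prod_closed)
    \<comment> \<open>Central elements have degree zero, so products with them are not
      twisted.\<close>
    show "central ?D \<in> hom (add_monoid R) ?D"
      by (rule homI) (simp_all add: D G.central_eq_zact add.m_comm)
    show "central ?D x \<otimes>\<^bsub>?D\<^esub> g = g \<otimes>\<^bsub>?D\<^esub> central ?D x"
      if "x \<in> carrier R" "g \<in> carrier ?D" for x g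
      using that by (simp add: D G.central_eq_zact)
    show "grading ?D (central ?D x) = \<zero>\<^bsub>R\<^esub>" if "x \<in> carrier R" for x
      using that by (simp add: D G.grading_central)
  qed (rule abelian_group_axioms)
qed

section \<open>The braided product of two groups\<close>

locale graded_pair = generalized_ring R + G1: centrally_graded_group R G1
    + G2: centrally_graded_group R G2
  for R :: "('g, 'm) ring_scheme" (structure) and G1 :: "('a, 'g) graded_group"
    and G2 :: "('b, 'g) graded_group"
begin

lemma zrel_iff:
  "(p, q) \<in> zrel R G1 G2 \<longleftrightarrow>
    (\<exists>x\<in>carrier R. \<exists>g1\<in>carrier G1. \<exists>g2\<in>carrier G2.
      p = (zact G1 x g1, g2) \<and> q = (g1, zact G2 x g2))"
  by (auto simp: zrel_def zact_def)

lemma zrel_iff':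
  assumes "g1 \<in> carrier G1" "g2 \<in> carrier G2" "h1 \<in> carrier G1" "h2 \<in> carrier G2"
  shows "((g1, g2), (h1, h2)) \<in> zrel R G1 G2 \<longleftrightarrow>
    (\<exists>x\<in>carrier R. g1 = zact G1 x h1 \<and> h2 = zact G2 x g2)"
  using assms by (auto simp: zrel_iff)

text \<open>\<open>zrel\<close> is the orbit relation of \<Gamma> acting by Z^(-x) on the first
  factor and Z^x on the second. The group structure of \<Gamma> supplies the three
  witnesses.\<close>

lemma equiv_zrel: "equiv (carrier G1 \<times> carrier G2) (zrel R G1 G2)"
proof (rule equivI)
  show "zrel R G1 G2 \<subseteq> (carrier G1 \<times> carrier G2) \<times> (carrier G1 \<times> carrier G2)"
    by (auto simp: zrel_iff)
  show "refl_on (carrier G1 \<times> carrier G2) (zrel R G1 G2)"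
    by (auto simp: refl_on_def zrel_iff' intro!: bexI[of _ \<zero>])
  show "sym (zrel R G1 G2)"
  proof (rule symI)
    fix p q assume "(p, q) \<in> zrel R G1 G2"
    then obtain x g1 g2 where x: "x \<in> carrier R" "g1 \<in> carrier G1" "g2 \<in> carrier G2"
      "p = (zact G1 x g1, g2)" "q = (g1, zact G2 x g2)"
      by (auto simp: zrel_iff)
    then show "(q, p) \<in> zrel R G1 G2"
      by (auto simp: zrel_iff' l_neg intro!: bexI[of _ "\<ominus> x"])
  qed
  show "trans (zrel R G1 G2)"
  proof (rule transI)
    fix p q r assume "(p, q) \<in> zrel R G1 G2" "(q, r) \<in> zrel R G1 G2"
    then obtain x y g1 g2 h1 h2 where x: "x \<in> carrier R" "g1 \<in> carrier G1" "g2 \<in> carrier G2"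
      "p = (zact G1 x g1, g2)" "q = (g1, zact G2 x g2)"
      "y \<in> carrier R" "h1 \<in> carrier G1" "h2 \<in> carrier G2"
      "q = (zact G1 y h1, h2)" "r = (h1, zact G2 y h2)"
      by (auto simp: zrel_iff)
    then show "(p, r) \<in> zrel R G1 G2"
      by (auto simp: zrel_iff' add.m_comm intro!: bexI[of _ "x \<oplus> y"])
  qed
qed

abbreviation P :: "(('a \<times> 'b) set, 'g) graded_group" where
  "P \<equiv> braided_prod R G1 G2"

abbreviation cls :: "'a \<Rightarrow> 'b \<Rightarrow> ('a \<times> 'b) set" where
  "cls \<equiv> zclass R G1 G2"

lemma cls_eq_iff:
  assumes "g1 \<in> carrier G1" "g2 \<in> carrier G2" "h1 \<in> carrier G1" "h2 \<in> carrier G2"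
  shows "cls g1 g2 = cls h1 h2 \<longleftrightarrow> (\<exists>x\<in>carrier R. g1 = zact G1 x h1 \<and> h2 = zact G2 x g2)"
  using assms eq_equiv_class_iff[OF equiv_zrel] by (simp add: zclass_def zrel_iff')

text \<open>As a rewrite rule this gives classes a normal form, with all powers of Z in the left
  factor.\<close>

lemma cls_zact_right [simp]:
  assumes "x \<in> carrier R" "g1 \<in> carrier G1" "g2 \<in> carrier G2"
  shows "cls g1 (zact G2 x g2) = cls (zact G1 x g1) g2"
  using assms by (metis cls_eq_iff G1.zact_closed G2.zact_closed)

lemma zshift_eq_cls [simp]: "zshift R G1 G2 x g1 g2 = cls (zact G1 x g1) g2"
  by (simp add: zshift_def zact_def)

lemma cls_closed [simp]:
  "\<lbrakk> g1 \<in> carrier G1; g2 \<in> carrier G2 \<rbrakk> \<Longrightarrow> cls g1 g2 \<in> carrier P"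
  by (simp add: braided_prod_def zclass_def quotientI)

lemma carrier_cases:
  assumes "X \<in> carrier P"
  obtains g1 g2 where "g1 \<in> carrier G1" "g2 \<in> carrier G2" "X = cls g1 g2"
  using assms by (auto simp: braided_prod_def zclass_def elim!: quotientE)

text \<open>Well-definedness has to be checked only on the pairs that define
  \<open>zrel\<close>.\<close>

lemma the_elem_cls:
  assumes "g1 \<in> carrier G1" "g2 \<in> carrier G2"
    and "\<And>x h1 h2. \<lbrakk> x \<in> carrier R; h1 \<in> carrier G1; h2 \<in> carrier G2 \<rbrakk>
      \<Longrightarrow> f (zact G1 x h1, h2) = f (h1, zact G2 x h2)"
  shows "the_elem (f ` cls g1 g2) = f (g1, g2)"
  unfolding zclass_def
  by (rule the_elem_image_class[OF equiv_zrel]) (use assms in \<open>auto simp: zrel_iff\<close>)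

text \<open>Independent of representatives: moving Z^x across a class leaves all degrees, hence the
  twist, unchanged, and the central factor can be pulled out of the product.\<close>

lemma mult_cls [simp]:
  assumes "g1 \<in> carrier G1" "g2 \<in> carrier G2" "h1 \<in> carrier G1" "h2 \<in> carrier G2"
  shows "cls g1 g2 \<otimes>\<^bsub>P\<^esub> cls h1 h2 =
    cls (zact G1 (grading G1 h1 \<otimes> grading G2 g2) (g1 \<otimes>\<^bsub>G1\<^esub> h1)) (g2 \<otimes>\<^bsub>G2\<^esub> h2)"
proof -
  let ?f = "\<lambda>((g1, g2), (h1, h2)). zshift R G1 G2 (grading G1 h1 \<otimes> grading G2 g2)
    (g1 \<otimes>\<^bsub>G1\<^esub> h1) (g2 \<otimes>\<^bsub>G2\<^esub> h2)"
  have "the_elem (?f ` (cls g1 g2 \<times> cls h1 h2)) = ?f ((g1, g2), (h1, h2))"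
    unfolding zclass_def
    by (rule the_elem_image_class2[OF equiv_zrel])
      (use assms in \<open>auto simp: zrel_iff prod_closed add.m_comm\<close>)
  then show ?thesis
    by (simp add: braided_prod_def)
qed

lemma grading_cls [simp]:
  assumes "g1 \<in> carrier G1" "g2 \<in> carrier G2"
  shows "grading P (cls g1 g2) = grading G1 g1 \<oplus> grading G2 g2"
  using the_elem_cls[OF assms, of "\<lambda>(g1, g2). grading G1 g1 \<oplus> grading G2 g2"]
  by (simp add: braided_prod_def)

lemma one_cls: "\<one>\<^bsub>P\<^esub> = cls \<one>\<^bsub>G1\<^esub> \<one>\<^bsub>G2\<^esub>"
  by (simp add: braided_prod_def)

lemma central_cls:
  "x \<in> carrier R \<Longrightarrow> central P x = cls (zact G1 x \<one>\<^bsub>G1\<^esub>) \<one>\<^bsub>G2\<^esub>"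
  by (simp add: braided_prod_def G1.central_eq_zact)

text \<open>The twist vanishes because the second component of \<open>central P x\<close> has degree
  zero. With this rule the product can itself serve as a factor.\<close>

lemma zact_cls [simp]:
  "\<lbrakk> x \<in> carrier R; g1 \<in> carrier G1; g2 \<in> carrier G2 \<rbrakk>
    \<Longrightarrow> zact P x (cls g1 g2) = cls (zact G1 x g1) g2"
  by (simp add: zact_def[of P] central_cls)

text \<open>For associativity on classes of g, h, k, both bracketings have the exponent d(h1)d(g2) +
  d(k1)d(g2) + d(k1)d(h2).\<close>

lemma group_braided_prod: "group P"
proof (rule groupI)
  fix X assume "X \<in> carrier P"
  then obtain g1 g2 where X: "g1 \<in> carrier G1" "g2 \<in> carrier G2" "X = cls g1 g2"
    by (rule carrier_cases)
  show "\<one>\<^bsub>P\<^esub> \<otimes>\<^bsub>P\<^esub> X = X"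
    using X by (simp add: one_cls)
  \<comment> \<open>The componentwise inverse times \<open>X\<close> is twisted by -d(g1)d(g2); the
    witness compensates for it in its first component.\<close>
  show "\<exists>Y\<in>carrier P. Y \<otimes>\<^bsub>P\<^esub> X = \<one>\<^bsub>P\<^esub>"
    using X
    by (intro bexI[of _ "cls (zact G1 (grading G1 g1 \<otimes> grading G2 g2) (inv\<^bsub>G1\<^esub> g1)) (inv\<^bsub>G2\<^esub> g2)"])
      (simp_all add: one_cls prod_closed prod_minus_right l_neg)
next
  fix X Y assume "X \<in> carrier P" "Y \<in> carrier P"
  then show "X \<otimes>\<^bsub>P\<^esub> Y \<in> carrier P"
    by (auto simp: prod_closed elim!: carrier_cases)
next
  fix X Y Z assume "X \<in> carrier P" "Y \<in> carrier P" "Z \<in> carrier P"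
  then show "X \<otimes>\<^bsub>P\<^esub> Y \<otimes>\<^bsub>P\<^esub> Z = X \<otimes>\<^bsub>P\<^esub> (Y \<otimes>\<^bsub>P\<^esub> Z)"
    by (auto simp: prod_closed prod_add_left prod_add_right G1.m_assoc G2.m_assoc add.m_ac
        elim!: carrier_cases)
qed (simp add: one_cls)

lemma centrally_graded_group_braided_prod: "centrally_graded_group R P"
proof (intro centrally_graded_group.intro centrally_graded_group_axioms.intro group_braided_prod)
  show "grading P \<in> hom P (add_monoid R)"
    by (auto simp: hom_def prod_closed add.m_ac elim!: carrier_cases)
  show "central P \<in> hom (add_monoid R) P"
    by (rule homI) (simp_all add: central_cls add.m_comm)
  show "central P x \<otimes>\<^bsub>P\<^esub> X = X \<otimes>\<^bsub>P\<^esub> central P x" if "x \<in> carrier R" "X \<in> carrier P" for x X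
    using that by (auto simp: central_cls elim!: carrier_cases)
  show "grading P (central P x) = \<zero>" if "x \<in> carrier R" for x
    using that by (simp add: central_cls)
qed (rule abelian_group_axioms)

section \<open>The braiding\<close>

lemma braiding_cls [simp]:
  assumes "g1 \<in> carrier G1" "g2 \<in> carrier G2"
  shows "braiding R G1 G2 (cls g1 g2) =
    zclass R G2 G1 (zact G2 (grading G2 g2 \<otimes> grading G1 g1) g2) g1"
proof -
  interpret swap: graded_pair R G2 G1 ..
  show ?thesis
    using the_elem_cls[OF assms, of "\<lambda>(g1, g2). zshift R G2 G1 (grading G2 g2 \<otimes> grading G1 g1) g2 g1"]
    by (simp add: braiding_def prod_closed add.m_comm)
qed

text \<open>Braiding twice multiplies by Z to the power d(g2)d(g1) + d(g1)d(g2), which is zero by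
  skewness. So the opposite braiding is the inverse.\<close>

lemma braiding_braiding:
  assumes "skew R" "X \<in> carrier P"
  shows "braiding R G2 G1 (braiding R G1 G2 X) = X"
proof -
  interpret swap: graded_pair R G2 G1 ..
  show ?thesis
    using assms by (auto simp: prod_closed skew_def elim!: carrier_cases)
qed

lemma braiding_closed: "X \<in> carrier P \<Longrightarrow> braiding R G1 G2 X \<in> carrier (braided_prod R G2 G1)"
proof -
  interpret swap: graded_pair R G2 G1 ..
  show "X \<in> carrier P \<Longrightarrow> braiding R G1 G2 X \<in> carrier (braided_prod R G2 G1)"
    by (auto simp: prod_closed elim!: carrier_cases)
qed

lemma braiding_iso:
  assumes "skew R"
  shows "braiding R G1 G2 \<in> iso P (braided_prod R G2 G1)"
proof (rule isoI)
  interpret swap: graded_pair R G2 G1 ..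
  show "bij_betw (braiding R G1 G2) (carrier P) (carrier swap.P)"
    by (rule bij_betwI[where g = "braiding R G2 G1"])
      (use assms in \<open>auto simp: braiding_closed swap.braiding_closed braiding_braiding
        swap.braiding_braiding\<close>)
  show "braiding R G1 G2 \<in> hom P swap.P"
  proof (rule homI)
    fix X Y assume "X \<in> carrier P" "Y \<in> carrier P"
    then obtain g1 g2 h1 h2 where X: "g1 \<in> carrier G1" "g2 \<in> carrier G2" "X = cls g1 g2"
      and Y: "h1 \<in> carrier G1" "h2 \<in> carrier G2" "Y = cls h1 h2"
      by (metis carrier_cases)
    let ?a = "grading G1 g1" and ?b = "grading G2 g2" and ?c = "grading G1 h1" and ?d = "grading G2 h2"
    \<comment> \<open>On the left is the exponent of the braided product \<open>X\<close>
      \<open>Y\<close>: the twist of the braiding, then that of the multiplication. Skewness removes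
      the mixed terms in \<open>?b\<close> and \<open>?c\<close>, leaving the exponent of the
      product of the braided classes.\<close>
    have "(?b \<oplus> ?d) \<otimes> (?a \<oplus> ?c) \<oplus> ?c \<otimes> ?b
        = (?b \<otimes> ?a \<oplus> ?d \<otimes> ?c \<oplus> ?d \<otimes> ?a) \<oplus> (?b \<otimes> ?c \<oplus> ?c \<otimes> ?b)"
      using X Y by (simp add: prod_closed prod_add_left prod_add_right add.m_ac)
    also have "\<dots> = ?b \<otimes> ?a \<oplus> ?d \<otimes> ?c \<oplus> ?d \<otimes> ?a"
      using X Y assms by (simp add: prod_closed skew_def)
    finally have "?c \<otimes> ?b \<oplus> (?b \<oplus> ?d) \<otimes> (?a \<oplus> ?c) = ?d \<otimes> ?a \<oplus> (?b \<otimes> ?a \<oplus> ?d \<otimes> ?c)"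
      using X Y by (simp add: prod_closed add.m_comm)
    then show "braiding R G1 G2 (X \<otimes>\<^bsub>P\<^esub> Y) = braiding R G1 G2 X \<otimes>\<^bsub>swap.P\<^esub> braiding R G1 G2 Y"
      using X Y by (simp add: prod_closed add.m_ac)
  qed (rule braiding_closed)
qed

end

section \<open>Associativity of the iterated product\<close>

locale graded_triple = generalized_ring R + G1: centrally_graded_group R G1
    + G2: centrally_graded_group R G2 + G3: centrally_graded_group R G3
  for R :: "('g, 'm) ring_scheme" (structure) and G1 :: "('a, 'g) graded_group"
    and G2 :: "('b, 'g) graded_group" and G3 :: "('c, 'g) graded_group"

sublocale graded_triple \<subseteq> P12: graded_pair R G1 G2 ..

sublocale graded_triple \<subseteq> P23: graded_pair R G2 G3 ..

text \<open>\<open>L\<close> and \<open>M\<close> are the outer pairs of the two bracketings; the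
  inner product qualifies as a factor because it is centrally graded.\<close>

sublocale graded_triple \<subseteq> L: graded_pair R "braided_prod R G1 G2" G3
  by (intro graded_pair.intro generalized_ring_axioms P12.centrally_graded_group_braided_prod
      G3.centrally_graded_group_axioms)

sublocale graded_triple \<subseteq> M: graded_pair R G1 "braided_prod R G2 G3"
  by (intro graded_pair.intro generalized_ring_axioms P23.centrally_graded_group_braided_prod
      G1.centrally_graded_group_axioms)

context graded_triple
begin

lemma nested_left_cases:
  assumes "X \<in> carrier L.P"
  obtains g1 g2 g3 where "g1 \<in> carrier G1" "g2 \<in> carrier G2" "g3 \<in> carrier G3"
    "X = L.cls (P12.cls g1 g2) g3"
  using assms by (metis L.carrier_cases P12.carrier_cases)

lemma nested_right_cases:
  assumes "X \<in> carrier M.P"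
  obtains g1 g2 g3 where "g1 \<in> carrier G1" "g2 \<in> carrier G2" "g3 \<in> carrier G3"
    "X = M.cls g1 (P23.cls g2 g3)"
  using assms by (metis M.carrier_cases P23.carrier_cases)

text \<open>
  An instance of \<open>cls_zact_right\<close> that the simplifier cannot find, because \<open>zact_cls\<close> has already
  rewritten the action on \<open>[g\<^sub>2, g\<^sub>3]\<close>.
\<close>

lemma cls_cls_zact [simp]:
  assumes "x \<in> carrier R" "g1 \<in> carrier G1" "g2 \<in> carrier G2" "g3 \<in> carrier G3"
  shows "M.cls g1 (P23.cls (zact G2 x g2) g3) = M.cls (zact G1 x g1) (P23.cls g2 g3)"
  using M.cls_zact_right[of x g1 "P23.cls g2 g3"] assms by simp

text \<open>Two nested choices of representatives must be harmless. \<open>F\<close> settles the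
  inner one, moving Z^x between the first two factors; the outer one moves Z^x between the inner
  class and the third factor.\<close>

lemma braided_assoc_cls [simp]:
  assumes "g1 \<in> carrier G1" "g2 \<in> carrier G2" "g3 \<in> carrier G3"
  shows "braided_assoc R G1 G2 G3 (L.cls (P12.cls g1 g2) g3) = M.cls g1 (P23.cls g2 g3)"
proof -
  let ?F = "\<lambda>(Y, g3). the_elem ((\<lambda>(g1, g2). M.cls g1 (P23.cls g2 g3)) ` Y)"
  have F: "?F (P12.cls h1 h2, h3) = M.cls h1 (P23.cls h2 h3)"
    if "h1 \<in> carrier G1" "h2 \<in> carrier G2" "h3 \<in> carrier G3" for h1 h2 h3
    using P12.the_elem_cls[OF that(1,2), of "\<lambda>(g1, g2). M.cls g1 (P23.cls g2 h3)"] that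
    by simp
  have "the_elem (?F ` L.cls (P12.cls g1 g2) g3) = ?F (P12.cls g1 g2, g3)"
  proof (rule L.the_elem_cls)
    fix x Y h3
    assume *: "x \<in> carrier R" "Y \<in> carrier P12.P" "h3 \<in> carrier G3"
    then obtain h1 h2 where h: "h1 \<in> carrier G1" "h2 \<in> carrier G2" "Y = P12.cls h1 h2"
      by (metis P12.carrier_cases)
    then show "?F (zact P12.P x Y, h3) = ?F (Y, zact G3 x h3)"
      using * F[of "zact G1 x h1" h2 h3] F[of h1 h2 "zact G3 x h3"] by simp
  qed (use assms in simp_all)
  also have "\<dots> = M.cls g1 (P23.cls g2 g3)"
    using F assms by blast
  finally show ?thesis
    by (simp only: braided_assoc_def)
qed

lemma inj_on_braided_assoc: "inj_on (braided_assoc R G1 G2 G3) (carrier L.P)"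
proof (rule inj_onI)
  fix X Y assume "X \<in> carrier L.P" "Y \<in> carrier L.P"
    and eq: "braided_assoc R G1 G2 G3 X = braided_assoc R G1 G2 G3 Y"
  then obtain g1 g2 g3 h1 h2 h3
    where g: "g1 \<in> carrier G1" "g2 \<in> carrier G2" "g3 \<in> carrier G3"
      and X: "X = L.cls (P12.cls g1 g2) g3"
      and h: "h1 \<in> carrier G1" "h2 \<in> carrier G2" "h3 \<in> carrier G3"
      and Y: "Y = L.cls (P12.cls h1 h2) h3"
    by (metis nested_left_cases)
  have "M.cls g1 (P23.cls g2 g3) = M.cls h1 (P23.cls h2 h3)"
    using eq g h by (simp add: X Y)
  \<comment> \<open>Equality of nested classes is unpacked from the outside in: x passes between the
    first factor and the inner class, then y between the second and third factors.\<close>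
  then obtain x where x: "x \<in> carrier R" "g1 = zact G1 x h1"
    and "P23.cls h2 h3 = P23.cls (zact G2 x g2) g3"
    using g h by (auto simp: M.cls_eq_iff)
  then obtain y where y: "y \<in> carrier R" "h2 = zact G2 y (zact G2 x g2)" "g3 = zact G3 y h3"
    using g h by (auto simp: P23.cls_eq_iff)
  \<comment> \<open>Both sides normalize to the class with first entry Z^(x+y) h1, second entry g2
    and third entry h3.\<close>
  show "X = Y"
    using g h x y by (simp add: X Y add.m_comm)
qed

lemma braided_assoc_iso: "braided_assoc R G1 G2 G3 \<in> iso L.P M.P"
proof (rule isoI)
  have closed: "braided_assoc R G1 G2 G3 X \<in> carrier M.P" if "X \<in> carrier L.P" for X
    using that by (auto elim!: nested_left_cases)
  show "braided_assoc R G1 G2 G3 \<in> hom L.P M.P"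
  proof (rule homI)
    fix X Y assume "X \<in> carrier L.P" "Y \<in> carrier L.P"
    then obtain g1 g2 g3 h1 h2 h3
      where g: "g1 \<in> carrier G1" "g2 \<in> carrier G2" "g3 \<in> carrier G3"
        and X: "X = L.cls (P12.cls g1 g2) g3"
        and h: "h1 \<in> carrier G1" "h2 \<in> carrier G2" "h3 \<in> carrier G3"
        and Y: "Y = L.cls (P12.cls h1 h2) h3"
      by (metis nested_left_cases)
    let ?a = "grading G1 h1" and ?b = "grading G2 h2" and ?c = "grading G2 g2" and ?d = "grading G3 g3"
    \<comment> \<open>Each side adds the outer and inner twists of one bracketing. The outer twist
      involves the degree of an inner class, which is a sum.\<close>
    have "(?a \<oplus> ?b) \<otimes> ?d \<oplus> ?a \<otimes> ?c = ?b \<otimes> ?d \<oplus> ?a \<otimes> (?c \<oplus> ?d)"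
      using g h by (simp add: prod_closed prod_add_left prod_add_right add.m_ac)
    then show "braided_assoc R G1 G2 G3 (X \<otimes>\<^bsub>L.P\<^esub> Y)
        = braided_assoc R G1 G2 G3 X \<otimes>\<^bsub>M.P\<^esub> braided_assoc R G1 G2 G3 Y"
      using g h by (simp add: X Y prod_closed add.m_comm)
  qed (rule closed)
  have "carrier M.P \<subseteq> braided_assoc R G1 G2 G3 ` carrier L.P"
  proof
    fix X assume "X \<in> carrier M.P"
    then obtain g1 g2 g3 where "g1 \<in> carrier G1" "g2 \<in> carrier G2" "g3 \<in> carrier G3"
      "X = M.cls g1 (P23.cls g2 g3)"
      by (rule nested_right_cases)
    then show "X \<in> braided_assoc R G1 G2 G3 ` carrier L.P"
      by (intro image_eqI[of _ _ "L.cls (P12.cls g1 g2) g3"]) simp_all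
  qed
  then show "bij_betw (braided_assoc R G1 G2 G3) (carrier L.P) (carrier M.P)"
    using closed by (auto simp: bij_betw_def inj_on_braided_assoc)
qed

end

text \<open>The equations on classes certify that each use of \<open>the_elem\<close> in the
  definitions yields the intended value.\<close>

theorem theorem0p7:
  fixes \<Gamma> :: "('g, 'm) ring_scheme"
  assumes "generalized_ring \<Gamma>"
  shows
    "(\<forall>G :: ('a, 'g) graded_group. centrally_graded_group \<Gamma> G \<longrightarrow>
        centrally_graded_group \<Gamma> (braided_dual \<Gamma> G))
   \<and> (\<forall>(G1 :: ('a, 'g) graded_group) (G2 :: ('b, 'g) graded_group).
        centrally_graded_group \<Gamma> G1 \<and> centrally_graded_group \<Gamma> G2 \<longrightarrow>
        equiv (carrier G1 \<times> carrier G2) (zrel \<Gamma> G1 G2)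
      \<and> (\<forall>x\<in>carrier \<Gamma>. \<forall>g1\<in>carrier G1. \<forall>g2\<in>carrier G2.
           zshift \<Gamma> G1 G2 x g1 g2 = zclass \<Gamma> G1 G2 g1 (central G2 x \<otimes>\<^bsub>G2\<^esub> g2))
      \<and> centrally_graded_group \<Gamma> (braided_prod \<Gamma> G1 G2)
      \<and> (\<forall>g1\<in>carrier G1. \<forall>g2\<in>carrier G2. \<forall>h1\<in>carrier G1. \<forall>h2\<in>carrier G2.
           zclass \<Gamma> G1 G2 g1 g2 \<otimes>\<^bsub>braided_prod \<Gamma> G1 G2\<^esub> zclass \<Gamma> G1 G2 h1 h2
             = zshift \<Gamma> G1 G2 (grading G1 h1 \<otimes>\<^bsub>\<Gamma>\<^esub> grading G2 g2)
                 (g1 \<otimes>\<^bsub>G1\<^esub> h1) (g2 \<otimes>\<^bsub>G2\<^esub> h2))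
      \<and> (\<forall>g1\<in>carrier G1. \<forall>g2\<in>carrier G2.
           grading (braided_prod \<Gamma> G1 G2) (zclass \<Gamma> G1 G2 g1 g2)
             = grading G1 g1 \<oplus>\<^bsub>\<Gamma>\<^esub> grading G2 g2))
   \<and> (\<forall>(G1 :: ('a, 'g) graded_group) (G2 :: ('b, 'g) graded_group)
        (G3 :: ('c, 'g) graded_group).
        centrally_graded_group \<Gamma> G1 \<and> centrally_graded_group \<Gamma> G2
          \<and> centrally_graded_group \<Gamma> G3 \<longrightarrow>
        braided_assoc \<Gamma> G1 G2 G3
          \<in> iso (braided_prod \<Gamma> (braided_prod \<Gamma> G1 G2) G3)
                (braided_prod \<Gamma> G1 (braided_prod \<Gamma> G2 G3))
      \<and> (\<forall>g1\<in>carrier G1. \<forall>g2\<in>carrier G2. \<forall>g3\<in>carrier G3.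
           braided_assoc \<Gamma> G1 G2 G3
             (zclass \<Gamma> (braided_prod \<Gamma> G1 G2) G3 (zclass \<Gamma> G1 G2 g1 g2) g3)
             = zclass \<Gamma> G1 (braided_prod \<Gamma> G2 G3) g1 (zclass \<Gamma> G2 G3 g2 g3)))
   \<and> (skew \<Gamma> \<longrightarrow>
      (\<forall>(G1 :: ('a, 'g) graded_group) (G2 :: ('b, 'g) graded_group).
        centrally_graded_group \<Gamma> G1 \<and> centrally_graded_group \<Gamma> G2 \<longrightarrow>
        braiding \<Gamma> G1 G2 \<in> iso (braided_prod \<Gamma> G1 G2) (braided_prod \<Gamma> G2 G1)
      \<and> (\<forall>g1\<in>carrier G1. \<forall>g2\<in>carrier G2.
           braiding \<Gamma> G1 G2 (zclass \<Gamma> G1 G2 g1 g2)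
             = zshift \<Gamma> G2 G1 (grading G2 g2 \<otimes>\<^bsub>\<Gamma>\<^esub> grading G1 g1) g2 g1)))"
proof (intro conjI allI impI)
  fix G :: "('a, 'g) graded_group"
  assume "centrally_graded_group \<Gamma> G"
  then show "centrally_graded_group \<Gamma> (braided_dual \<Gamma> G)"
    by (rule centrally_graded_group_braided_dual[OF assms])
next
  fix G1 :: "('a, 'g) graded_group" and G2 :: "('b, 'g) graded_group"
  assume "centrally_graded_group \<Gamma> G1 \<and> centrally_graded_group \<Gamma> G2"
  then interpret graded_pair \<Gamma> G1 G2
    using assms by (simp add: graded_pair_def)
  show "equiv (carrier G1 \<times> carrier G2) (zrel \<Gamma> G1 G2)"
    by (rule equiv_zrel)
  show "\<forall>x\<in>carrier \<Gamma>. \<forall>g1\<in>carrier G1. \<forall>g2\<in>carrier G2.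
    zshift \<Gamma> G1 G2 x g1 g2 = zclass \<Gamma> G1 G2 g1 (central G2 x \<otimes>\<^bsub>G2\<^esub> g2)"
    by (simp flip: zact_def)
  show "centrally_graded_group \<Gamma> (braided_prod \<Gamma> G1 G2)"
    by (rule centrally_graded_group_braided_prod)
  show "\<forall>g1\<in>carrier G1. \<forall>g2\<in>carrier G2. \<forall>h1\<in>carrier G1. \<forall>h2\<in>carrier G2.
    zclass \<Gamma> G1 G2 g1 g2 \<otimes>\<^bsub>braided_prod \<Gamma> G1 G2\<^esub> zclass \<Gamma> G1 G2 h1 h2
    = zshift \<Gamma> G1 G2 (grading G1 h1 \<otimes>\<^bsub>\<Gamma>\<^esub> grading G2 g2)
    (g1 \<otimes>\<^bsub>G1\<^esub> h1) (g2 \<otimes>\<^bsub>G2\<^esub> h2)"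
    by simp
  show "\<forall>g1\<in>carrier G1. \<forall>g2\<in>carrier G2.
    grading (braided_prod \<Gamma> G1 G2) (zclass \<Gamma> G1 G2 g1 g2)
    = grading G1 g1 \<oplus>\<^bsub>\<Gamma>\<^esub> grading G2 g2"
    by simp
next
  fix G1 :: "('a, 'g) graded_group" and G2 :: "('b, 'g) graded_group"
    and G3 :: "('c, 'g) graded_group"
  assume "centrally_graded_group \<Gamma> G1 \<and> centrally_graded_group \<Gamma> G2
    \<and> centrally_graded_group \<Gamma> G3"
  then interpret graded_triple \<Gamma> G1 G2 G3
    using assms by (simp add: graded_triple_def)
  show "braided_assoc \<Gamma> G1 G2 G3
          \<in> iso (braided_prod \<Gamma> (braided_prod \<Gamma> G1 G2) G3)
                (braided_prod \<Gamma> G1 (braided_prod \<Gamma> G2 G3))"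
    by (rule braided_assoc_iso)
  show "\<forall>g1\<in>carrier G1. \<forall>g2\<in>carrier G2. \<forall>g3\<in>carrier G3.
           braided_assoc \<Gamma> G1 G2 G3
             (zclass \<Gamma> (braided_prod \<Gamma> G1 G2) G3 (zclass \<Gamma> G1 G2 g1 g2) g3)
             = zclass \<Gamma> G1 (braided_prod \<Gamma> G2 G3) g1 (zclass \<Gamma> G2 G3 g2 g3)"
    by simp
next
  fix G1 :: "('a, 'g) graded_group" and G2 :: "('b, 'g) graded_group"
  assume skew: "skew \<Gamma>" and "centrally_graded_group \<Gamma> G1 \<and> centrally_graded_group \<Gamma> G2"
  then interpret graded_pair \<Gamma> G1 G2
    using assms by (simp add: graded_pair_def)
  \<comment> \<open>Supplies the rule for \<open>zshift\<close> with the factors exchanged.\<close>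
  interpret swap: graded_pair \<Gamma> G2 G1 ..
  show "braiding \<Gamma> G1 G2 \<in> iso (braided_prod \<Gamma> G1 G2) (braided_prod \<Gamma> G2 G1)"
    using skew by (rule braiding_iso)
  show "\<forall>g1\<in>carrier G1. \<forall>g2\<in>carrier G2.
           braiding \<Gamma> G1 G2 (zclass \<Gamma> G1 G2 g1 g2)
             = zshift \<Gamma> G2 G1 (grading G2 g2 \<otimes>\<^bsub>\<Gamma>\<^esub> grading G1 g1) g2 g1"
    by simp
qed

end
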